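(* Let $\mathbf{x}=(\mathbf{x}_1,\mathbf{x}_2)$ be a random variable composed of two independent random variables $\mathbf{x}_1$ and $\mathbf{x}_2$. Let $\mathbf{y}_1$ be a random variable (the surrogate task) such that $H(\mathbf{y}_1\mid\mathbf{x}_1)=0$, and let $\beta$ be a constant. Let $\mathbf{z}$ be any representation of $\mathbf{x}$ that is sufficient for $\mathbf{y}_1$ and that minimizes, among the sufficient representations of $\mathbf{x}$ for $\mathbf{y}_1$, the loss $$\mathcal{L}=I(\mathbf{x}_1\mathbf{x}_2;\mathbf{z})-\beta\, I(\mathbf{z};\mathbf{y}_1).$$ Then $I(\mathbf{x}_2;\mathbf{z})=0$.
   Context: All random variables are discrete; $H$ denotes Shannon entropy, $I$ (conditional) mutual information, and $I(\mathbf{x}_1\mathbf{x}_2;\mathbf{z})$ is the mutual information between the pair $(\mathbf{x}_1,\mathbf{x}_2)$ and $\mathbf{z}$. The information quantities appearing in $\mathcal{L}$ are assumed finite. Representation: a random variable $\mathbf{z}$ (jointly distributed with the others) is a representation of $\mathbf{x}$ if, once $\mathbf{x}$ is observed, $\mathbf{z}$ is conditionally independent of every other variable in the system: $I(\mathbf{z};\mathbf{a}\mid\mathbf{x}\mathbf{b})=0$ for all other variables (or groups of variables) $\mathbf{a},\mathbf{b}$ in the system. In particular $I(\mathbf{y}_1;\mathbf{z}\mid\mathbf{x})=0$. The representation need not be a deterministic function of $\mathbf{x}$. Sufficiency: a representation $\mathbf{z}$ of $\mathbf{x}$ is sufficient for $\mathbf{y}$ if and only if $I(\mathbf{x};\mathbf{y}\mid\mathbf{z})=0$.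 *)

theory Defs
  imports "HOL-Probability.Probability"
begin

text \<open>
  Only the joint law of the variables matters, so a discrete probability space is a \<open>pmf\<close>
  and a discrete random variable is any function on its sample type. Logarithms are to base 2.
  All information quantities are \<open>ennreal\<close>-valued because on countable alphabets they may be
  infinite, whereas the library's Bochner integrals would silently return 0 in that case.
\<close>

definition rel_entropy :: "'a pmf \<Rightarrow> 'a pmf \<Rightarrow> ennreal" where
  "rel_entropy p q =
     (if set_pmf p \<subseteq> set_pmf q \<and>
         integrable (measure_pmf p) (entropy_density 2 (measure_pmf q) (measure_pmf p))
      then ennreal (KL_divergence 2 (measure_pmf q) (measure_pmf p)) else \<infinity>)"

lemma density_pmf_ratio: assumes "set_pmf p \<subseteq> set_pmf q"
  shows "density (measure_pmf q) (\<lambda>x. ennreal (pmf p x / pmf q x)) = measure_pmf p"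
proof -
  have "density (measure_pmf q) (\<lambda>x. ennreal (pmf p x / pmf q x)) = density (count_space UNIV) (\<lambda>x. ennreal (pmf q x) * ennreal (pmf p x / pmf q x))"
    by (subst measure_pmf_eq_density, subst density_density_eq) auto
  also have "\<dots> = density (count_space UNIV) (\<lambda>x. ennreal (pmf p x))"
  proof (rule density_cong, goal_cases)
    case 3 show ?case using assms
      by (auto simp: ennreal_mult[symmetric] AE_count_space set_pmf_iff subset_iff)
  qed auto
  finally show ?thesis by (simp add: measure_pmf_eq_density)
qed

lemma RN_deriv_pmf: assumes "set_pmf p \<subseteq> set_pmf q"
  shows "AE x in measure_pmf q. ennreal (pmf p x / pmf q x) = RN_deriv (measure_pmf q) (measure_pmf p) x"
  by (rule measure_pmf.RN_deriv_unique) (use density_pmf_ratio[OF assms] in auto)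

lemma KL_divergence_pmf: assumes "set_pmf p \<subseteq> set_pmf q"
  shows "KL_divergence 2 (measure_pmf q) (measure_pmf p) = measure_pmf.expectation p (\<lambda>x. log 2 (pmf p x / pmf q x))"
  unfolding KL_divergence_def entropy_density_def
  apply (rule integral_cong_AE)
  using RN_deriv_pmf[OF assms] assms apply (auto simp: AE_measure_pmf_iff)
  by (metis divide_nonneg_nonneg enn2real_ennreal pmf_nonneg subsetD)

lemma KL_divergence_pmf_nonneg: assumes "set_pmf p \<subseteq> set_pmf q" "integrable (measure_pmf p) (entropy_density 2 (measure_pmf q) (measure_pmf p))"
  shows "0 \<le> KL_divergence 2 (measure_pmf q) (measure_pmf p)"
proof -
  interpret information_space "measure_pmf q" 2 by standard auto
  let ?D = "\<lambda>x. pmf p x / pmf q x"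
  have d: "density (measure_pmf q) (\<lambda>x. ennreal (?D x)) = measure_pmf p" using density_pmf_ratio[OF assms(1)] .
  have "integrable (measure_pmf p) (\<lambda>x. log 2 (?D x))"
    apply (rule integrable_cong_AE_imp[OF assms(2)]) 
    using RN_deriv_pmf[OF assms(1)] assms(1) apply (auto simp: AE_measure_pmf_iff entropy_density_def)
    by (metis divide_nonneg_nonneg enn2real_ennreal pmf_nonneg subsetD)
  hence "integrable (measure_pmf q) (\<lambda>x. ?D x * log 2 (?D x))"
    unfolding d[symmetric] by (subst (asm) integrable_density) auto
  from KL_nonneg[OF _ _ _ this] show ?thesis unfolding d by (auto simp: measure_pmf.prob_space_axioms)
qed

definition mutual_info :: "'w pmf \<Rightarrow> ('w \<Rightarrow> 'a) \<Rightarrow> ('w \<Rightarrow> 'b) \<Rightarrow> ennreal" where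
  "mutual_info P X Y =
     rel_entropy (map_pmf (\<lambda>w. (X w, Y w)) P) (pair_pmf (map_pmf X P) (map_pmf Y P))"

text \<open>
  \<open>I(X;Y|Z)\<close> is the average of \<open>I(X;Y|Z=c)\<close> over the law of \<open>Z\<close>; only values \<open>c\<close> of positive
  probability, for which \<open>cond_pmf\<close> is meaningful, contribute.
\<close>

definition cond_mutual_info ::
  "'w pmf \<Rightarrow> ('w \<Rightarrow> 'a) \<Rightarrow> ('w \<Rightarrow> 'b) \<Rightarrow> ('w \<Rightarrow> 'c) \<Rightarrow> ennreal" where
  "cond_mutual_info P X Y Z =
     (\<integral>\<^sup>+ c. mutual_info (cond_pmf P {w. Z w = c}) X Y \<partial>measure_pmf (map_pmf Z P))"

definition shannon_entropy :: "'w pmf \<Rightarrow> ('w \<Rightarrow> 'a) \<Rightarrow> ennreal" where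
  "shannon_entropy P X =
     (\<integral>\<^sup>+ a. ennreal (- log 2 (pmf (map_pmf X P) a)) \<partial>measure_pmf (map_pmf X P))"

definition cond_shannon_entropy :: "'w pmf \<Rightarrow> ('w \<Rightarrow> 'a) \<Rightarrow> ('w \<Rightarrow> 'c) \<Rightarrow> ennreal" where
  "cond_shannon_entropy P X Z =
     (\<integral>\<^sup>+ c. shannon_entropy (cond_pmf P {w. Z w = c}) X \<partial>measure_pmf (map_pmf Z P))"

definition indep_rv :: "'w pmf \<Rightarrow> ('w \<Rightarrow> 'a) \<Rightarrow> ('w \<Rightarrow> 'b) \<Rightarrow> bool" where
  "indep_rv P X Y \<longleftrightarrow> map_pmf (\<lambda>w. (X w, Y w)) P = pair_pmf (map_pmf X P) (map_pmf Y P)"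

text \<open>
  The system consists of \<open>x\<^sub>1\<close>, \<open>x\<^sub>2\<close>, \<open>y\<^sub>1\<close>. A group of system variables is the tuple of the
  selected ones; the components that are not selected are masked by \<open>None\<close>.
\<close>

datatype sys_var = VX1 | VX2 | VY1

definition var_group ::
  "('w \<Rightarrow> 'a) \<Rightarrow> ('w \<Rightarrow> 'b) \<Rightarrow> ('w \<Rightarrow> 'y) \<Rightarrow> sys_var set \<Rightarrow>
   'w \<Rightarrow> 'a option \<times> 'b option \<times> 'y option" where
  "var_group x1 x2 y1 G w =
     (if VX1 \<in> G then Some (x1 w) else None,
      if VX2 \<in> G then Some (x2 w) else None,
      if VY1 \<in> G then Some (y1 w) else None)"

text \<open>
  A variable \<open>z\<close> jointly distributed with the system on \<open>P\<close> is given by a joint law \<open>Q\<close> whose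
  first marginal is \<open>P\<close>, with \<open>z = snd\<close>; \<open>z\<close> thus need not be a function on the sample space
  of \<open>P\<close>, in particular not a function of \<open>x\<close>. System variables are read off \<open>Q\<close> through \<open>fst\<close>.
\<close>

definition representation ::
  "'w pmf \<Rightarrow> ('w \<Rightarrow> 'a) \<Rightarrow> ('w \<Rightarrow> 'b) \<Rightarrow> ('w \<Rightarrow> 'y) \<Rightarrow> ('w \<times> 'z) pmf \<Rightarrow> bool" where
  "representation P x1 x2 y1 Q \<longleftrightarrow>
     map_pmf fst Q = P \<and>
     (\<forall>A B. cond_mutual_info Q snd (\<lambda>w. var_group x1 x2 y1 A (fst w))
              (\<lambda>w. ((x1 (fst w), x2 (fst w)), var_group x1 x2 y1 B (fst w))) = 0)"

definition sufficient ::
  "('w \<Rightarrow> 'a) \<Rightarrow> ('w \<Rightarrow> 'b) \<Rightarrow> ('w \<Rightarrow> 'y) \<Rightarrow> ('w \<times> 'z) pmf \<Rightarrow> bool" where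
  "sufficient x1 x2 y1 Q \<longleftrightarrow>
     cond_mutual_info Q (\<lambda>w. (x1 (fst w), x2 (fst w))) (\<lambda>w. y1 (fst w)) snd = 0"

definition finite_loss ::
  "('w \<Rightarrow> 'a) \<Rightarrow> ('w \<Rightarrow> 'b) \<Rightarrow> ('w \<Rightarrow> 'y) \<Rightarrow> ('w \<times> 'z) pmf \<Rightarrow> bool" where
  "finite_loss x1 x2 y1 Q \<longleftrightarrow>
     mutual_info Q (\<lambda>w. (x1 (fst w), x2 (fst w))) snd < \<infinity> \<and>
     mutual_info Q snd (\<lambda>w. y1 (fst w)) < \<infinity>"

definition loss ::
  "real \<Rightarrow> ('w \<Rightarrow> 'a) \<Rightarrow> ('w \<Rightarrow> 'b) \<Rightarrow> ('w \<Rightarrow> 'y) \<Rightarrow> ('w \<times> 'z) pmf \<Rightarrow> real" where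
  "loss \<beta> x1 x2 y1 Q =
     enn2real (mutual_info Q (\<lambda>w. (x1 (fst w), x2 (fst w))) snd)
     - \<beta> * enn2real (mutual_info Q snd (\<lambda>w. y1 (fst w)))"

text \<open>
  Competitors take values in \<open>nat\<close>: every discrete variable is, up to an injective relabelling
  of its countably many values, of this form, and relabelling changes no information quantity.
\<close>

definition loss_minimizing_representation ::
  "real \<Rightarrow> 'w pmf \<Rightarrow> ('w \<Rightarrow> 'a) \<Rightarrow> ('w \<Rightarrow> 'b) \<Rightarrow> ('w \<Rightarrow> 'y) \<Rightarrow> ('w \<times> 'z) pmf \<Rightarrow> bool" where
  "loss_minimizing_representation \<beta> P x1 x2 y1 Q \<longleftrightarrow>
     representation P x1 x2 y1 Q \<and> sufficient x1 x2 y1 Q \<and> finite_loss x1 x2 y1 Q \<and>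
     (\<forall>Q' :: ('w \<times> nat) pmf.
        representation P x1 x2 y1 Q' \<and> sufficient x1 x2 y1 Q' \<and> finite_loss x1 x2 y1 Q' \<longrightarrow>
        loss \<beta> x1 x2 y1 Q \<le> loss \<beta> x1 x2 y1 Q')"

end

theory Submission
  imports Defs
begin

text \<open>
  Write \<open>x = (x1, x2)\<close>. Since \<open>y1\<close> is a function of \<open>x1\<close>, a representation \<open>z\<close> is sufficient exactly
  when \<open>y1\<close> is also a function of \<open>z\<close>; hence \<open>I(z;y1) = H(y1)\<close> for all sufficient \<open>z\<close>, and
  minimizing the loss means minimizing \<open>I(x;z)\<close>. As \<open>y1\<close> itself is a sufficient representation,
  \<open>I(x;z) \<le> H(y1)\<close>. The difference \<open>I(x;z) - H(y1)\<close> is \<open>I(x;z|y1)\<close>, the relative entropy between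
  the law of \<open>(x,z)\<close> and the law that makes \<open>x\<close> and \<open>z\<close> conditionally independent given \<open>y1\<close>, so
  these laws coincide. Finally \<open>x2\<close> is independent of \<open>y1\<close>, hence of \<open>z\<close>.
\<close>

section \<open>Relative entropy and mutual information of mass functions\<close>

lemma rel_entropy_pmf:
  assumes "set_pmf p \<subseteq> set_pmf q"
  defines "f \<equiv> \<lambda>x. log 2 (pmf p x / pmf q x)"
  shows "rel_entropy p q =
    (if integrable (measure_pmf p) f then ennreal (measure_pmf.expectation p f) else \<infinity>)"
proof -
  have "AE x in measure_pmf p. entropy_density 2 (measure_pmf q) (measure_pmf p) x = f x"
    using RN_deriv_pmf[OF assms(1)] assms(1)
    apply (auto simp: AE_measure_pmf_iff entropy_density_def f_def)
    by (metis divide_nonneg_nonneg enn2real_ennreal pmf_nonneg subsetD)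
  hence "integrable (measure_pmf p) (entropy_density 2 (measure_pmf q) (measure_pmf p))
    \<longleftrightarrow> integrable (measure_pmf p) f"
    by (intro integrable_cong_AE) auto
  thus ?thesis
    using assms(1) KL_divergence_pmf[OF assms(1)] by (simp add: rel_entropy_def f_def)
qed

text \<open>The equality case of Gibbs' inequality. A zero value excludes the infinite branch; since
  \<open>ennreal\<close> truncates, it only yields a nonpositive divergence, which nonnegativity
  then makes zero.\<close>

lemma rel_entropy_eq_0_iff: "rel_entropy p q = 0 \<longleftrightarrow> p = q"
proof
  assume zero: "rel_entropy p q = 0"
  interpret information_space "measure_pmf q" 2 by standard auto
  have ac: "set_pmf p \<subseteq> set_pmf q"
    and int: "integrable (measure_pmf p) (entropy_density 2 (measure_pmf q) (measure_pmf p))"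
    and le: "KL_divergence 2 (measure_pmf q) (measure_pmf p) \<le> 0"
    using zero by (auto simp: rel_entropy_def ennreal_eq_0_iff split: if_splits)
  have "absolutely_continuous (measure_pmf q) (measure_pmf p)"
    unfolding density_pmf_ratio[OF ac, symmetric]
    by (intro absolutely_continuousI_density) auto
  from KL_eq_0_iff_eq_ac[OF measure_pmf.prob_space_axioms this _ int]
    le KL_divergence_pmf_nonneg[OF ac int]
  show "p = q" by (simp add: measure_pmf_inject)
next
  assume "p = q"
  \<comment> \<open>Off the support the ratio is 0 / 0 = 0, and \<open>log 2 0 = 0\<close>.\<close>
  moreover have "log 2 (pmf q x / pmf q x) = 0" for x
    by (cases "pmf q x = 0") (auto simp: log_def)
  ultimately show "rel_entropy p q = 0" by (subst rel_entropy_pmf) auto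
qed

lemma mutual_info_eq_0_iff: "mutual_info P X Y = 0 \<longleftrightarrow> indep_rv P X Y"
  by (simp add: mutual_info_def indep_rv_def rel_entropy_eq_0_iff)

lemma cond_mutual_info_eq_0_iff:
  "cond_mutual_info P X Y Z = 0 \<longleftrightarrow>
    (\<forall>v\<in>set_pmf P. indep_rv (cond_pmf P {w. Z w = Z v}) X Y)"
  by (simp add: cond_mutual_info_def nn_integral_0_iff_AE AE_measure_pmf_iff mutual_info_eq_0_iff)

text \<open>Pointwise mutual information, taken as a function of the outcome and not of the pair of
  values, so that the densities of different pairs can be subtracted under one expectation.\<close>

definition info_density :: "'w pmf \<Rightarrow> ('w \<Rightarrow> 'a) \<Rightarrow> ('w \<Rightarrow> 'b) \<Rightarrow> 'w \<Rightarrow> real" where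
  "info_density P X Y w = log 2 (pmf (map_pmf (\<lambda>w. (X w, Y w)) P) (X w, Y w)
     / (pmf (map_pmf X P) (X w) * pmf (map_pmf Y P) (Y w)))"

lemma mutual_info_expectation:
  "mutual_info P X Y = (if integrable (measure_pmf P) (info_density P X Y)
     then ennreal (measure_pmf.expectation P (info_density P X Y)) else \<infinity>)"
  unfolding mutual_info_def by (subst rel_entropy_pmf) (auto simp: pmf_pair info_density_def[abs_def])

section \<open>Almost sure functional dependence and entropy\<close>

lemma pmf_map_pos: "w \<in> set_pmf P \<Longrightarrow> 0 < pmf (map_pmf X P) (X w)"
  by (simp add: pmf_positive)

definition determines :: "'w pmf \<Rightarrow> ('w \<Rightarrow> 'a) \<Rightarrow> ('w \<Rightarrow> 'b) \<Rightarrow> bool" where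
  "determines P X Y \<longleftrightarrow> (\<forall>v\<in>set_pmf P. \<forall>w\<in>set_pmf P. X v = X w \<longrightarrow> Y v = Y w)"

lemma pmf_map_cong_fibre:
  assumes "\<And>v. v \<in> set_pmf P \<Longrightarrow> X v = a \<longleftrightarrow> Y v = b"
  shows "pmf (map_pmf X P) a = pmf (map_pmf Y P) b"
  unfolding pmf_map using assms
  by (intro measure_pmf.finite_measure_eq_AE) (auto simp: AE_measure_pmf_iff)

lemma determinesD:
  assumes "determines P X Y" "v \<in> set_pmf P" "w \<in> set_pmf P" "X v = X w"
  shows "Y v = Y w"
  using assms unfolding determines_def by blast

lemma pmf_map_pair_determines:
  assumes "determines P X Y" "w \<in> set_pmf P"
  shows "pmf (map_pmf (\<lambda>w. (X w, Y w)) P) (X w, Y w) = pmf (map_pmf X P) (X w)"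
proof (rule pmf_map_cong_fibre)
  fix v assume "v \<in> set_pmf P"
  with determinesD[OF assms(1) this assms(2)] show "(X v, Y v) = (X w, Y w) \<longleftrightarrow> X v = X w"
    by blast
qed

lemma shannon_entropy_expectation:
  "shannon_entropy P Y = (\<integral>\<^sup>+ w. ennreal (- log 2 (pmf (map_pmf Y P) (Y w))) \<partial>measure_pmf P)"
  by (simp add: shannon_entropy_def)

lemma info_density_determines:
  assumes "determines P X Y" "w \<in> set_pmf P"
  shows "info_density P X Y w = - log 2 (pmf (map_pmf Y P) (Y w))"
  using pmf_map_pos[OF assms(2), of X] pmf_map_pos[OF assms(2), of Y]
  by (simp add: info_density_def pmf_map_pair_determines[OF assms] log_divide)

lemma info_density_determines_nonneg:
  assumes "determines P X Y"
  shows "AE w in measure_pmf P. 0 \<le> info_density P X Y w"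
  using pmf_map_pos[of _ P Y] pmf_le_1[of "map_pmf Y P"]
  by (auto simp: AE_measure_pmf_iff info_density_determines[OF assms])

text \<open>The density equals the surprisal of \<open>Y\<close>, which is nonnegative; so
  integrability fails exactly when the entropy is infinite, and the identity covers that case
  too.\<close>

lemma mutual_info_determines:
  assumes "determines P X Y"
  shows "mutual_info P X Y = shannon_entropy P Y"
proof -
  let ?h = "info_density P X Y"
  have "shannon_entropy P Y = (\<integral>\<^sup>+ w. ennreal (?h w) \<partial>measure_pmf P)"
    unfolding shannon_entropy_expectation
    by (intro nn_integral_cong_AE) (simp add: AE_measure_pmf_iff info_density_determines[OF assms])
  thus ?thesis
    using nn_integral_eq_integral[OF _ info_density_determines_nonneg[OF assms]]
      integrableI_nonneg[OF _ info_density_determines_nonneg[OF assms]]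
    by (cases "integrable (measure_pmf P) ?h") (simp_all add: mutual_info_expectation, metis top.not_eq_extremum)
qed

lemma shannon_entropy_cong:
  assumes "determines P X Y" "determines P Y X"
  shows "shannon_entropy P X = shannon_entropy P Y"
proof -
  have "pmf (map_pmf X P) (X w) = pmf (map_pmf Y P) (Y w)" if "w \<in> set_pmf P" for w
    by (rule pmf_map_cong_fibre) (meson assms that determinesD)
  thus ?thesis unfolding shannon_entropy_expectation
    by (intro nn_integral_cong_AE) (simp add: AE_measure_pmf_iff)
qed

text \<open>An average of nonnegative entropies vanishes only if each fibre of \<open>X\<close> of
  positive probability has entropy zero; then any value of \<open>Y\<close> occurring there has
  probability 1.\<close>

lemma cond_shannon_entropy_eq_0_imp_determines:
  assumes "cond_shannon_entropy P Y X = 0"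
  shows "determines P X Y"
  unfolding determines_def
proof (intro ballI impI)
  fix v w assume vw: "v \<in> set_pmf P" "w \<in> set_pmf P" "X v = X w"
  let ?R = "cond_pmf P {u. X u = X w}"
  have ne: "set_pmf P \<inter> {u. X u = X w} \<noteq> {}" using vw by auto
  have "shannon_entropy ?R Y = 0"
    using assms vw by (auto simp: cond_shannon_entropy_def nn_integral_0_iff_AE AE_measure_pmf_iff)
  moreover have w: "w \<in> set_pmf ?R" using ne vw by simp
  ultimately have "0 \<le> log 2 (pmf (map_pmf Y ?R) (Y w))"
    by (auto simp: shannon_entropy_expectation nn_integral_0_iff_AE AE_measure_pmf_iff ennreal_eq_0_iff)
  hence "1 \<le> pmf (map_pmf Y ?R) (Y w)"
    using pmf_map_pos[OF w, of Y] by simp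
  hence "pmf (map_pmf Y ?R) (Y w) = 1"
    using pmf_le_1 by (metis order_antisym)
  hence "AE u in measure_pmf ?R. Y u = Y w"
    by (simp add: pmf_map measure_pmf.prob_eq_1)
  thus "Y v = Y w" using vw unfolding AE_measure_pmf_iff set_cond_pmf[OF ne] by blast
qed

section \<open>Independence and conditional mutual information of determined variables\<close>

lemma indep_rv_determines_const:
  assumes "indep_rv P X Y" "determines P X Y" "v \<in> set_pmf P" "w \<in> set_pmf P"
  shows "Y v = Y w"
proof -
  \<comment> \<open>Under independence every value of \<open>X\<close> occurs together with every
    value of \<open>Y\<close>, so one outcome links \<open>v\<close> and \<open>w\<close>.\<close>
  have "(X v, Y w) \<in> set_pmf (map_pmf (\<lambda>w. (X w, Y w)) P)"
    using assms by (simp add: indep_rv_def)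
  then obtain u where "u \<in> set_pmf P" "X u = X v" "Y u = Y w" by auto
  with assms show ?thesis unfolding determines_def by metis
qed

lemma indep_rv_const:
  assumes "\<And>w. w \<in> set_pmf P \<Longrightarrow> Y w = c"
  shows "indep_rv P X Y"
proof -
  have "map_pmf Y P = return_pmf c"
    using assms by (subst map_pmf_cong[OF refl, of P Y "\<lambda>_. c"]) auto
  moreover have "map_pmf (\<lambda>w. (X w, Y w)) P = map_pmf (\<lambda>w. (X w, c)) P"
    using assms by (intro map_pmf_cong) auto
  ultimately show ?thesis
    by (simp add: indep_rv_def pair_return_pmf2 map_pmf_comp)
qed

lemma indep_rv_sym:
  assumes "indep_rv P X Y"
  shows "indep_rv P Y X"
proof -
  have "map_pmf (\<lambda>w. (Y w, X w)) P = map_pmf (\<lambda>(a, b). (b, a)) (map_pmf (\<lambda>w. (X w, Y w)) P)"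
    by (simp add: map_pmf_comp)
  also have "\<dots> = pair_pmf (map_pmf Y P) (map_pmf X P)"
    using assms pair_commute_pmf[of "map_pmf Y P" "map_pmf X P"] by (simp add: indep_rv_def)
  finally show ?thesis by (simp add: indep_rv_def)
qed

lemma indep_rv_commute: "indep_rv P X Y \<longleftrightarrow> indep_rv P Y X"
  by (rule iffI; erule indep_rv_sym)

text \<open>Within a fibre of \<open>Z\<close>, \<open>Y\<close> is both independent of
  \<open>X\<close> and a function of it, hence constant. This turns sufficiency into functional
  dependence on the representation.\<close>

lemma cond_mutual_info_eq_0_imp_determines:
  assumes "cond_mutual_info P X Y Z = 0" "determines P X Y"
  shows "determines P Z Y"
  unfolding determines_def
proof (intro ballI impI)
  fix v w assume vw: "v \<in> set_pmf P" "w \<in> set_pmf P" "Z v = Z w"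
  hence ne: "set_pmf P \<inter> {u. Z u = Z w} \<noteq> {}" by auto
  have "indep_rv (cond_pmf P {u. Z u = Z w}) X Y"
    using assms(1) vw by (simp add: cond_mutual_info_eq_0_iff)
  thus "Y v = Y w"
  proof (rule indep_rv_determines_const)
    show "determines (cond_pmf P {u. Z u = Z w}) X Y"
      using assms(2) unfolding determines_def set_cond_pmf[OF ne] by blast
  qed (use ne vw in auto)
qed

text \<open>\<open>Y\<close> is constant on each fibre of \<open>Z\<close>, and a constant is
  independent of everything. For the competitor this yields sufficiency and, with arguments swapped,
  the representation property.\<close>

lemma cond_mutual_info_determines:
  assumes "determines P Z Y"
  shows "cond_mutual_info P X Y Z = 0"
  unfolding cond_mutual_info_eq_0_iff
proof
  fix v assume v: "v \<in> set_pmf P"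
  hence ne: "set_pmf P \<inter> {u. Z u = Z v} \<noteq> {}" by auto
  show "indep_rv (cond_pmf P {w. Z w = Z v}) X Y"
  proof (rule indep_rv_const)
    fix w assume "w \<in> set_pmf (cond_pmf P {w. Z w = Z v})"
    with assms v show "Y w = Y v" unfolding set_cond_pmf[OF ne] determines_def by blast
  qed
qed

lemma cond_mutual_info_commute:
  "cond_mutual_info P X Y Z = 0 \<longleftrightarrow> cond_mutual_info P Y X Z = 0"
  by (simp add: cond_mutual_info_eq_0_iff indep_rv_commute[of _ X Y])

section \<open>Conditional laws and the conditionally independent coupling\<close>

lemma pmf_map_cond_pmf:
  assumes "v \<in> set_pmf P"
  shows "pmf (map_pmf X (cond_pmf P {w. Y w = Y v})) a =
    pmf (map_pmf (\<lambda>w. (X w, Y w)) P) (a, Y v) / pmf (map_pmf Y P) (Y v)"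
proof -
  have ne: "set_pmf P \<inter> {w. Y w = Y v} \<noteq> {}" using assms by auto
  have "measure (measure_pmf (cond_pmf P {w. Y w = Y v})) A =
      measure (measure_pmf P) ({w. Y w = Y v} \<inter> A) / measure (measure_pmf P) {w. Y w = Y v}" for A
    unfolding cond_pmf.rep_eq[OF ne]
    by (intro measure_uniform_measure) (use emeasure_measure_pmf_not_zero[OF ne] in auto)
  moreover have "{w. Y w = Y v} \<inter> X -` {a} = (\<lambda>w. (X w, Y w)) -` {(a, Y v)}"
    "{w. Y w = Y v} = Y -` {Y v}"
    by auto
  ultimately show ?thesis by (simp add: pmf_map)
qed

lemma bind_cond_pmf_fibres: "bind_pmf (map_pmf Y P) (\<lambda>c. cond_pmf P {w. Y w = c}) = P"
proof (rule bind_cond_pmf_cancel)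
  fix c v assume "Y v = c"
  thus "measure (measure_pmf P) {w. Y w = c} = measure (measure_pmf (map_pmf Y P)) {a. Y v = a}"
    by (simp add: vimage_def eq_commute[of c])
qed auto

text \<open>The \<open>(X, Z)\<close> marginal of the Markov chain \<open>X - Y - Z\<close> built
  from the laws of \<open>(X, Y)\<close> and \<open>(Y, Z)\<close>.\<close>

definition cond_indep_law ::
  "'w pmf \<Rightarrow> ('w \<Rightarrow> 'a) \<Rightarrow> ('w \<Rightarrow> 'b) \<Rightarrow> ('w \<Rightarrow> 'c) \<Rightarrow> ('a \<times> 'b) pmf" where
  "cond_indep_law P X Z Y = bind_pmf (map_pmf Y P) (\<lambda>c.
     pair_pmf (map_pmf X (cond_pmf P {w. Y w = c})) (map_pmf Z (cond_pmf P {w. Y w = c})))"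

text \<open>\<open>X w\<close> forces the value of \<open>Y\<close>, so a single term of the mixture
  survives. Both conditional probabilities there carry a division by the mass of \<open>Y w\<close>,
  and the mixing weight cancels one of them.\<close>

lemma pmf_cond_indep_law:
  assumes "determines P X Y" "determines P Z Y" "w \<in> set_pmf P"
  shows "pmf (cond_indep_law P X Z Y) (X w, Z w) =
    pmf (map_pmf X P) (X w) * pmf (map_pmf Z P) (Z w) / pmf (map_pmf Y P) (Y w)"
proof -
  let ?R = "\<lambda>c. cond_pmf P {w. Y w = c}"
  have XY: "pmf (map_pmf X (?R (Y v))) (X w) =
      (if Y v = Y w then pmf (map_pmf X P) (X w) / pmf (map_pmf Y P) (Y w) else 0)"
    if "v \<in> set_pmf P" for v
  proof (cases "Y v = Y w")
    case True
    thus ?thesis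
      by (simp add: pmf_map_cond_pmf[OF assms(3)] pmf_map_pair_determines[OF assms(1,3)])
  next
    case False
    hence "(X w, Y v) \<notin> set_pmf (map_pmf (\<lambda>w. (X w, Y w)) P)"
      using determinesD[OF assms(1) _ assms(3)] by fastforce
    with False show ?thesis
      by (simp add: pmf_map_cond_pmf[OF that] set_pmf_iff del: set_map_pmf)
  qed
  have ZY: "pmf (map_pmf Z (?R (Y w))) (Z w) = pmf (map_pmf Z P) (Z w) / pmf (map_pmf Y P) (Y w)"
    by (simp add: pmf_map_cond_pmf[OF assms(3)] pmf_map_pair_determines[OF assms(2,3)])
  define k where "k = pmf (map_pmf X P) (X w) / pmf (map_pmf Y P) (Y w)
    * (pmf (map_pmf Z P) (Z w) / pmf (map_pmf Y P) (Y w))"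
  have "pmf (cond_indep_law P X Z Y) (X w, Z w) =
    measure_pmf.expectation (map_pmf Y P) (\<lambda>c. pmf (map_pmf X (?R c)) (X w) * pmf (map_pmf Z (?R c)) (Z w))"
    by (simp add: cond_indep_law_def pmf_bind pmf_pair)
  also have "\<dots> = measure_pmf.expectation (map_pmf Y P) (\<lambda>c. k * indicator {Y w} c)"
    using XY ZY by (intro integral_cong_AE) (auto simp: AE_measure_pmf_iff k_def split: split_indicator)
  also have "\<dots> = k * pmf (map_pmf Y P) (Y w)"
    by (simp add: measure_pmf_single del: integral_map_pmf)
  finally show ?thesis
    using pmf_map_pos[OF assms(3), of Y] by (simp add: k_def)
qed

lemma map_pmf_eq_cond_indep_law:
  assumes XY: "determines P X Y" and ZY: "determines P Z Y"
    and le: "mutual_info P X Z \<le> shannon_entropy P Y" and fin: "shannon_entropy P Y < \<infinity>"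
  shows "map_pmf (\<lambda>w. (X w, Z w)) P = cond_indep_law P X Z Y" (is "?p = ?q")
proof -
  let ?h = "info_density P X Y" and ?i = "info_density P X Z"
  have le': "mutual_info P X Z \<le> mutual_info P X Y" and fin': "mutual_info P X Y < \<infinity>"
    using le fin by (simp_all add: mutual_info_determines[OF XY])
  have int_h: "integrable (measure_pmf P) ?h"
    using fin' by (simp add: mutual_info_expectation split: if_splits)
  have int_i: "integrable (measure_pmf P) ?i"
    using le_less_trans[OF le' fin'] by (simp add: mutual_info_expectation split: if_splits)
  \<comment> \<open>As \<open>ennreal\<close> sends negatives to 0, the bound passes to real
    expectations only because the right-hand one is nonnegative.\<close>
  have "0 \<le> measure_pmf.expectation P ?h"
    by (intro integral_nonneg_AE info_density_determines_nonneg[OF XY])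
  with le' have exp_le: "measure_pmf.expectation P ?i \<le> measure_pmf.expectation P ?h"
    by (simp add: mutual_info_expectation int_h int_i)
  have q_pos: "0 < pmf ?q (X w, Z w)" if "w \<in> set_pmf P" for w
    using pmf_map_pos[OF that, of X] pmf_map_pos[OF that, of Y] pmf_map_pos[OF that, of Z]
    by (simp add: pmf_cond_indep_law[OF XY ZY that])
  hence sub: "set_pmf ?p \<subseteq> set_pmf ?q"
    by (auto simp: set_pmf_iff dest!: q_pos)
  define f where "f w = log 2 (pmf ?p (X w, Z w) / pmf ?q (X w, Z w))" for w
  \<comment> \<open>\<open>?h\<close> is the surprisal of \<open>Y\<close>, so dividing the joint
    mass by p(x) p(z) / p(y) gives the difference of the two densities.\<close>
  have "f w = ?i w - ?h w" if w: "w \<in> set_pmf P" for w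
    using pmf_map_pos[OF w, of X] pmf_map_pos[OF w, of Y] pmf_map_pos[OF w, of Z]
      pmf_map_pos[OF w, of "\<lambda>w. (X w, Z w)"]
    by (simp add: f_def pmf_cond_indep_law[OF XY ZY w] info_density_determines[OF XY w]
        info_density_def[of P X Z] log_divide log_mult)
  hence ae: "AE w in measure_pmf P. f w = ?i w - ?h w"
    by (simp add: AE_measure_pmf_iff)
  have "integrable (measure_pmf P) f"
    using integrable_cong_AE[OF _ _ ae] int_h int_i by simp
  moreover have "measure_pmf.expectation P f \<le> 0"
    using integral_cong_AE[OF _ _ ae] exp_le int_h int_i by simp
  ultimately have "rel_entropy ?p ?q = 0"
    by (simp add: rel_entropy_pmf[OF sub] f_def[abs_def] ennreal_eq_0_iff)
  thus ?thesis by (simp add: rel_entropy_eq_0_iff)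
qed

section \<open>Independence under functions and mixtures\<close>

lemma indep_rv_comp_left:
  assumes "indep_rv P X Z"
  shows "indep_rv P (\<lambda>w. f (X w)) Z"
proof -
  have "map_pmf (\<lambda>w. (f (X w), Z w)) P = map_pmf (\<lambda>(a, c). (f a, c)) (map_pmf (\<lambda>w. (X w, Z w)) P)"
    by (simp add: map_pmf_comp)
  also have "\<dots> = pair_pmf (map_pmf f (map_pmf X P)) (map_pmf Z P)"
    using assms map_pair[of f "\<lambda>c. c"] by (simp add: indep_rv_def)
  finally show ?thesis by (simp add: indep_rv_def map_pmf_comp)
qed

lemma indep_rv_determines:
  assumes "indep_rv P X Z" "determines P X Y"
  shows "indep_rv P Y Z"
proof -
  \<comment> \<open>Any outcome in the support may represent its fibre of \<open>X\<close>, as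
    \<open>Y\<close> takes the same value on all of them.\<close>
  define f where "f a = Y (SOME w. w \<in> set_pmf P \<and> X w = a)" for a
  have f: "f (X w) = Y w" if w: "w \<in> set_pmf P" for w
  proof -
    have "\<exists>v. v \<in> set_pmf P \<and> X v = X w" using w by blast
    from someI_ex[OF this] show ?thesis
      using assms(2) w unfolding determines_def f_def by blast
  qed
  have "map_pmf (\<lambda>w. (f (X w), Z w)) P = map_pmf (\<lambda>w. (Y w, Z w)) P"
    "map_pmf (\<lambda>w. f (X w)) P = map_pmf Y P"
    using f by (auto intro!: map_pmf_cong)
  with indep_rv_comp_left[OF assms(1), of f] show ?thesis by (simp add: indep_rv_def)
qed

lemma indep_rv_map_cond_pmf:
  assumes "indep_rv P X Y" "v \<in> set_pmf P"
  shows "map_pmf X (cond_pmf P {w. Y w = Y v}) = map_pmf X P"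
  using assms pmf_map_pos[OF assms(2), of Y]
  by (intro pmf_eqI) (simp add: pmf_map_cond_pmf indep_rv_def pmf_pair)

text \<open>Since \<open>g (X w)\<close> is independent of \<open>Y\<close>, its conditional law is
  the same on all fibres and comes out of the mixture; the remaining factors average to the law of
  \<open>Z\<close>.\<close>

lemma cond_indep_law_indep:
  assumes "map_pmf (\<lambda>w. (X w, Z w)) P = cond_indep_law P X Z Y"
    and "indep_rv P (\<lambda>w. g (X w)) Y"
  shows "indep_rv P (\<lambda>w. g (X w)) Z"
proof -
  let ?R = "\<lambda>c. cond_pmf P {w. Y w = c}"
  have "map_pmf (\<lambda>w. (g (X w), Z w)) P = map_pmf (\<lambda>(a, c). (g a, c)) (map_pmf (\<lambda>w. (X w, Z w)) P)"
    by (simp add: map_pmf_comp)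
  also have "\<dots> = bind_pmf (map_pmf Y P) (\<lambda>c. pair_pmf (map_pmf (\<lambda>w. g (X w)) (?R c)) (map_pmf Z (?R c)))"
    by (simp add: assms(1) cond_indep_law_def map_bind_pmf map_pmf_comp
        map_pair[of g "\<lambda>c. c", simplified])
  also have "\<dots> = bind_pmf (map_pmf Y P) (\<lambda>c. pair_pmf (map_pmf (\<lambda>w. g (X w)) P) (map_pmf Z (?R c)))"
    by (intro bind_pmf_cong refl) (auto simp: indep_rv_map_cond_pmf[OF assms(2)])
  also have "\<dots> = pair_pmf (map_pmf (\<lambda>w. g (X w)) P) (bind_pmf (map_pmf Y P) (\<lambda>c. map_pmf Z (?R c)))"
    unfolding pair_pmf_def by (subst bind_commute_pmf) (simp add: bind_assoc_pmf)
  also have "bind_pmf (map_pmf Y P) (\<lambda>c. map_pmf Z (?R c)) = map_pmf Z P"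
    unfolding map_bind_pmf[symmetric] bind_cond_pmf_fibres ..
  finally show ?thesis by (simp add: indep_rv_def)
qed

section \<open>Change of sample space and the minimality argument\<close>

lemma determines_map_pmf:
  "determines (map_pmf f P) X Y \<longleftrightarrow> determines P (\<lambda>w. X (f w)) (\<lambda>w. Y (f w))"
  by (simp add: determines_def)

lemma indep_rv_map_pmf:
  "indep_rv (map_pmf f P) X Y \<longleftrightarrow> indep_rv P (\<lambda>w. X (f w)) (\<lambda>w. Y (f w))"
  by (simp add: indep_rv_def map_pmf_comp)

lemma shannon_entropy_map_pmf:
  "shannon_entropy (map_pmf f P) X = shannon_entropy P (\<lambda>w. X (f w))"
  by (simp add: shannon_entropy_def map_pmf_comp)

theorem theorem3p1:
  fixes P :: "'w pmf"
    and x1 :: "'w \<Rightarrow> 'a" and x2 :: "'w \<Rightarrow> 'b" and y1 :: "'w \<Rightarrow> 'y"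
    and \<beta> :: real
    and Q :: "('w \<times> 'z) pmf"
  assumes "indep_rv P x1 x2"
    and "cond_shannon_entropy P y1 x1 = 0"
    and "loss_minimizing_representation \<beta> P x1 x2 y1 Q"
  shows "mutual_info Q (\<lambda>w. x2 (fst w)) snd = 0"
proof -
  have rep: "representation P x1 x2 y1 Q" and suf: "sufficient x1 x2 y1 Q"
    and fin: "finite_loss x1 x2 y1 Q"
    and min: "representation P x1 x2 y1 Q' \<Longrightarrow> sufficient x1 x2 y1 Q' \<Longrightarrow>
      finite_loss x1 x2 y1 Q' \<Longrightarrow> loss \<beta> x1 x2 y1 Q \<le> loss \<beta> x1 x2 y1 Q'"
    for Q' :: "('w \<times> nat) pmf"
    using assms(3) unfolding loss_minimizing_representation_def by blast+
  let ?X = "\<lambda>w. (x1 (fst w), x2 (fst w))" and ?Y = "\<lambda>w. y1 (fst w)"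
  have P: "map_pmf fst Q = P" using rep by (simp add: representation_def)
  have det1: "determines P x1 y1"
    by (rule cond_shannon_entropy_eq_0_imp_determines[OF assms(2)])
  hence det1Q: "determines Q (\<lambda>w. x1 (fst w)) ?Y"
    unfolding P[symmetric] determines_map_pmf .
  hence XY: "determines Q ?X ?Y"
    unfolding determines_def prod.inject by blast
  have ZY: "determines Q snd ?Y"
    using suf XY unfolding sufficient_def by (rule cond_mutual_info_eq_0_imp_determines)
  have HQ: "shannon_entropy Q ?Y = shannon_entropy P y1"
    by (simp add: P[symmetric] shannon_entropy_map_pmf)
  have IQ: "mutual_info Q snd ?Y = shannon_entropy P y1"
    by (simp add: mutual_info_determines[OF ZY] HQ)
  \<comment> \<open>Finiteness of this entropy is inherited from the finite loss of
    \<open>Q\<close>.\<close>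
  have H_fin: "shannon_entropy P y1 < \<infinity>"
    using fin by (simp add: finite_loss_def IQ)

  \<comment> \<open>The competitor is \<open>y1\<close> itself, with its values encoded in \<open>nat\<close>.\<close>
  define e where "e = to_nat_on (set_pmf (map_pmf y1 P))"
  \<comment> \<open>The support of a mass function is countable, so the encoding is injective on
    it.\<close>
  have e: "e (y1 v) = e (y1 w) \<longleftrightarrow> y1 v = y1 w" if "v \<in> set_pmf P" "w \<in> set_pmf P" for v w
    using that unfolding e_def by (subst inj_on_eq_iff[OF inj_on_to_nat_on]) auto
  define Q' where "Q' = map_pmf (\<lambda>w. (w, e (y1 w))) P"
  have XZ': "determines Q' ?X snd"
    using det1 e unfolding Q'_def determines_map_pmf unfolding fst_conv snd_conv determines_def prod.inject
    by blast
  have Z'Y': "determines Q' snd ?Y" and Y'Z': "determines Q' ?Y snd"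
    using e unfolding Q'_def determines_map_pmf unfolding fst_conv snd_conv determines_def by blast+
  have P': "map_pmf fst Q' = P" by (simp add: Q'_def map_pmf_comp)
  have HQ': "shannon_entropy Q' ?Y = shannon_entropy P y1"
    by (simp add: P'[symmetric] shannon_entropy_map_pmf)
  have IQ'1: "mutual_info Q' snd ?Y = shannon_entropy P y1"
    by (simp add: mutual_info_determines[OF Z'Y'] HQ')
  have IQ'2: "mutual_info Q' ?X snd = shannon_entropy P y1"
    by (simp add: mutual_info_determines[OF XZ'] shannon_entropy_cong[OF Z'Y' Y'Z'] HQ')
  \<comment> \<open>The competitor is a function of \<open>?X\<close>, hence constant once
    \<open>?X\<close> is fixed, whatever else is observed.\<close>
  have "cond_mutual_info Q' snd U (\<lambda>w. (?X w, V w)) = 0"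
    for U :: "'w \<times> nat \<Rightarrow> 'a option \<times> 'b option \<times> 'y option"
    and V :: "'w \<times> nat \<Rightarrow> 'a option \<times> 'b option \<times> 'y option"
    using XZ' by (subst cond_mutual_info_commute, intro cond_mutual_info_determines)
      (unfold determines_def prod.inject, blast)
  hence rep': "representation P x1 x2 y1 Q'"
    by (simp add: representation_def P')
  have suf': "sufficient x1 x2 y1 Q'"
    unfolding sufficient_def by (rule cond_mutual_info_determines[OF Z'Y'])
  have fin': "finite_loss x1 x2 y1 Q'"
    using H_fin by (simp add: finite_loss_def IQ'1 IQ'2)
  \<comment> \<open>The information about \<open>y1\<close> equals its entropy for both
    representations, so the \<beta> terms cancel for either sign of \<beta>.\<close>
  have le: "enn2real (mutual_info Q ?X snd) \<le> enn2real (shannon_entropy P y1)"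
    using min[OF rep' suf' fin'] by (simp add: loss_def IQ IQ'1 IQ'2)
  \<comment> \<open>\<open>enn2real\<close> maps infinity to 0, so the return to
    \<open>ennreal\<close> rests on finiteness of both sides.\<close>
  have "mutual_info Q ?X snd = ennreal (enn2real (mutual_info Q ?X snd))"
    using fin by (simp add: finite_loss_def)
  also have "\<dots> \<le> ennreal (enn2real (shannon_entropy P y1))"
    using le by (rule ennreal_leI)
  also have "\<dots> = shannon_entropy Q ?Y"
    using H_fin by (simp add: HQ)
  finally have "map_pmf (\<lambda>w. (?X w, snd w)) Q = cond_indep_law Q ?X snd ?Y"
    using H_fin by (intro map_pmf_eq_cond_indep_law[OF XY ZY]) (simp_all add: HQ)
  \<comment> \<open>\<open>y1\<close> is a function of \<open>x1\<close>, which is independent of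
    \<open>x2\<close>. Writing \<open>x2\<close> as \<open>snd\<close> of \<open>?X\<close> matches
    the coupling lemma with \<open>g = snd\<close>.\<close>
  moreover have "indep_rv Q (\<lambda>w. snd (?X w)) ?Y"
    using indep_rv_sym[OF indep_rv_determines[OF assms(1) det1]]
    by (simp add: P[symmetric] indep_rv_map_pmf)
  ultimately have "indep_rv Q (\<lambda>w. snd (?X w)) snd"
    by (rule cond_indep_law_indep)
  thus ?thesis by (simp add: mutual_info_eq_0_iff)
qed

end
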